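(* Suppose that $\kappa$ is an uncountable cardinal and $2^\mu<2^\kappa$ for all cardinals $\mu<\kappa$. Suppose also that $c:[2^\kappa]^2\to\kappa$ is almost $\Delta$-regressive. Then there are $c$-monochromatic odd cycles.
   Context: $2^\kappa$ also denotes the set of all functions from $\kappa$ to $2=\{0,1\}$; $[X]^2$ is the set of two-element subsets of $X$, and $c(x,y)$ abbreviates $c(\{x,y\})$. For distinct $x,y\in 2^\kappa$, $\Delta(x,y)=\min\{i<\kappa: x(i)\neq y(i)\}$. A colouring $c:[2^\kappa]^2\to\kappa$ is almost $\Delta$-regressive if there is an ordinal $\mu<\kappa$ such that $c(x,y)<\max\{\Delta(x,y),\mu\}$ for all $x\neq y$ in $2^\kappa$. A $c$-monochromatic odd cycle is an injective sequence $\langle x_i\mid i<k\rangle$ of elements of $2^\kappa$ with $k\geq 3$ odd such that $c$ is constant on $\{\{x_i,x_{i+1}\}\mid i+1<k\}\cup\{\{x_{k-1},x_0\}\}$. *)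

theory Defs
  imports Complex_Main "HOL-Library.Countable_Set" "HOL-Library.Ramsey"
begin

unbundle cardinal_syntax

text \<open>
  A cardinal \<open>\<kappa>\<close> is a relation with \<open>Card_order \<kappa>\<close>, i.e. an initial well-order. The ordinals
  below \<open>\<kappa>\<close> are represented by the elements of \<open>Field \<kappa>\<close>, and \<open>i < j\<close> is \<open>(i, j) \<in> \<kappa> - Id\<close>
  (the relation \<open>\<kappa>\<close> itself is reflexive).
\<close>

text \<open>
  The set of functions \<open>2\<^sup>\<kappa>\<close>, with \<open>2 = {0,1}\<close> rendered as \<^typ>\<open>bool\<close>. Functions in \<^const>\<open>Func\<close> take
  the value \<^const>\<open>undefined\<close> outside \<open>Field \<kappa>\<close>. This set is the carrier of the library's cardinal
  power \<open>ctwo ^c \<kappa>\<close>, which denotes the cardinality.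
\<close>

definition two_pow :: "'k rel \<Rightarrow> ('k \<Rightarrow> bool) set" where
  "two_pow \<kappa> = Func (Field \<kappa>) (UNIV :: bool set)"

definition Delta :: "'k rel \<Rightarrow> ('k \<Rightarrow> bool) \<Rightarrow> ('k \<Rightarrow> bool) \<Rightarrow> 'k" where
  "Delta \<kappa> x y = wo_rel.minim \<kappa> {i \<in> Field \<kappa>. x i \<noteq> y i}"

definition almost_Delta_regressive :: "'k rel \<Rightarrow> (('k \<Rightarrow> bool) set \<Rightarrow> 'k) \<Rightarrow> bool" where
  "almost_Delta_regressive \<kappa> c \<longleftrightarrow>
     (\<exists>\<mu> \<in> Field \<kappa>. \<forall>x \<in> two_pow \<kappa>. \<forall>y \<in> two_pow \<kappa>. x \<noteq> y \<longrightarrow>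
        (c {x, y}, wo_rel.max2 \<kappa> (Delta \<kappa> x y) \<mu>) \<in> \<kappa> - Id)"

text \<open>The sequence \<open>\<langle>x\<^sub>i | i < k\<rangle>\<close> is given by the values of \<open>x\<close> on \<open>{..<k}\<close>.\<close>

definition monochromatic_odd_cycle ::
    "'k rel \<Rightarrow> (('k \<Rightarrow> bool) set \<Rightarrow> 'k) \<Rightarrow> nat \<Rightarrow> (nat \<Rightarrow> 'k \<Rightarrow> bool) \<Rightarrow> bool" where
  "monochromatic_odd_cycle \<kappa> c k x \<longleftrightarrow>
     k \<ge> 3 \<and> odd k \<and> x ` {..<k} \<subseteq> two_pow \<kappa> \<and> inj_on x {..<k} \<and>
     (\<exists>j. \<forall>e \<in> {{x i, x (i + 1)} | i. i + 1 < k} \<union> {{x (k - 1), x 0}}. c e = j)"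

end

theory Submission
  imports Defs
begin

text \<open>
  If there is no monochromatic odd cycle, every colour class \<open>j\<close> is a bipartite graph; let \<open>f j\<close> be a
  2-colouring of it and put \<open>F x = (\<lambda>j. f j x)\<close>. Then \<open>F x\<close> and \<open>F y\<close> differ at \<open>c {x, y}\<close>, so
  \<open>\<Delta>(F x, F y) \<le> c {x, y} < max (\<Delta>(x, y)) \<mu>\<close>. By well-foundedness some iterates of \<open>F\<close> at
  distinct \<open>x\<close> and \<open>y\<close> differ below \<open>\<mu>\<close>, so \<open>x\<close> is determined by the sequence of restrictions of
  \<open>F\<^sup>n x\<close> to \<open>\<mu>\<close>. Hence \<open>2\<^sup>\<kappa> \<le> (2\<^sup>\<mu>)\<^sup>\<omega> = 2\<^sup>\<lambda>\<close> with \<open>\<lambda> = max |\<mu>| \<omega> < \<kappa>\<close>, a contradiction.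
\<close>

text \<open>A shortest odd closed walk is already a cycle: a repeated vertex would split it into two
  shorter closed walks whose lengths have an odd sum, so one of them would be odd. Irreflexivity
  excludes length 1.\<close>

lemma odd_closed_walk_imp_odd_cycle:
  assumes irrefl: "irrefl E" and walk: "(a, a) \<in> E ^^ n" "odd n"
  obtains k :: nat and x where "k \<ge> 3" "odd k" "inj_on x {..<k}"
    "\<forall>i. i + 1 < k \<longrightarrow> (x i, x (i + 1)) \<in> E" "(x (k - 1), x 0) \<in> E"
proof -
  define P where "P m \<longleftrightarrow> odd m \<and> (\<exists>a. (a, a) \<in> E ^^ m)" for m
  define k where "k = (LEAST m. P m)"
  have "P k" unfolding k_def using walk by (intro LeastI[of P n]) (auto simp: P_def)
  have minimal: "\<not> P m" if "m < k" for m using that not_less_Least unfolding k_def by blast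
  from \<open>P k\<close> obtain b where "odd k" and "(b, b) \<in> E ^^ k" by (auto simp: P_def)
  then obtain x where x: "x 0 = b" "x k = b" and step: "\<And>i. i < k \<Longrightarrow> (x i, x (Suc i)) \<in> E"
    by (auto simp: relpow_fun_conv)
  have sub: "(x i, x j) \<in> E ^^ (j - i)" if "i \<le> j" "j \<le> k" for i j
    unfolding relpow_fun_conv
    by (rule exI[of _ "\<lambda>l. x (i + l)"]) (use that step in auto)
  have "k \<noteq> 1" using step[of 0] x irrefl by (auto simp: irrefl_def)
  with \<open>odd k\<close> have "k \<ge> 3" by presburger
  have distinct: "x i \<noteq> x j" if ij: "i < j" "j < k" for i j
  proof
    assume eq: "x i = x j"
    have "(x i, x i) \<in> E ^^ (j - i)" using sub[of i j] ij eq by simp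
    then have even: "even (j - i)" using minimal[of "j - i"] ij unfolding P_def by (meson less_imp_diff_less)
    \<comment> \<open>the complementary closed walk, from \<open>x j\<close> through \<open>x k = x 0\<close> back to \<open>x i\<close>\<close>
    have "(x j, x i) \<in> E ^^ ((k - j) + (i - 0))"
      unfolding relpow_add using sub[of j k] sub[of 0 i] ij x by auto
    then have "even (k - j + i)" using minimal[of "k - j + i"] ij eq unfolding P_def by force
    with even \<open>odd k\<close> ij show False by presburger
  qed
  then have "inj_on x {..<k}" by (intro linorder_inj_onI) auto
  with \<open>k \<ge> 3\<close> \<open>odd k\<close> show thesis
    using step[of "k - 1"] x by (intro that[of k x]) (auto intro: step)
qed

text \<open>Each vertex is coloured by the parity of the walks reaching it from a chosen vertex of
  its component.\<close>

lemma two_colouring_if_no_odd_closed_walk: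
  assumes sym: "sym E" and no_odd: "\<And>a n. (a, a) \<in> E ^^ n \<Longrightarrow> even n"
  obtains f :: "'a \<Rightarrow> bool" where "\<And>x y. (x, y) \<in> E \<Longrightarrow> f x \<noteq> f y"
proof -
  define rep where "rep x = (SOME r. (r, x) \<in> E\<^sup>*)" for x
  define f where "f x \<longleftrightarrow> (\<exists>n. even n \<and> (rep x, x) \<in> E ^^ n)" for x
  have walk: "\<exists>n. (rep x, x) \<in> E ^^ n" for x
    using someI[of "\<lambda>r. (r, x) \<in> E\<^sup>*" x] rtrancl_imp_relpow
    unfolding rep_def by fast
  have reversed: "(b, a) \<in> E ^^ n" if "(a, b) \<in> E ^^ n" for a b n
    using that
  proof (induction n arbitrary: b)
    case (Suc n)
    then obtain d where "(a, d) \<in> E ^^ n" "(d, b) \<in> E" by auto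
    with Suc.IH sym show ?case by (meson relpow_Suc_I2 symD)
  qed auto
  have "f x \<noteq> f y" if edge: "(x, y) \<in> E" for x y
  proof -
    \<comment> \<open>\<open>SOME\<close> returns the same value for equal predicates, so adjacent
      vertices share their representative.\<close>
    have "(r, x) \<in> E\<^sup>* \<longleftrightarrow> (r, y) \<in> E\<^sup>*" for r
      using edge sym by (meson rtrancl.rtrancl_into_rtrancl symD)
    then have rep: "rep y = rep x" by (simp add: rep_def)
    have parity: "odd (m + n)"
      if "(rep x, x) \<in> E ^^ m" "(rep x, y) \<in> E ^^ n" for m n
    proof -
      have "(rep x, y) \<in> E ^^ Suc m" using that edge by auto
      with reversed[OF that(2)] have "(rep x, rep x) \<in> E ^^ (Suc m + n)"
        unfolding relpow_add by blast
      from no_odd[OF this] show ?thesis by simp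
    qed
    from walk[of x] walk[of y] rep obtain m n
      where "(rep x, x) \<in> E ^^ m" "(rep x, y) \<in> E ^^ n" by auto
    \<comment> \<open>\<open>parity\<close> covers all pairs of walks: two even ones are impossible,
      and if neither vertex had an even walk, then \<open>m\<close> and \<open>n\<close> would both
      be odd.\<close>
    with parity rep show ?thesis unfolding f_def by (metis even_add)
  qed
  with that show thesis by blast
qed

lemma monochromatic_odd_cycle_or_two_colourings:
  assumes "\<nexists>k x. monochromatic_odd_cycle \<kappa> c k x"
  obtains f :: "'k \<Rightarrow> ('k \<Rightarrow> bool) \<Rightarrow> bool"
  where "\<And>x y. x \<in> two_pow \<kappa> \<Longrightarrow> y \<in> two_pow \<kappa> \<Longrightarrow> x \<noteq> y \<Longrightarrow> f (c {x, y}) x \<noteq> f (c {x, y}) y"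
proof -
  have "\<exists>g. \<forall>x \<in> two_pow \<kappa>. \<forall>y \<in> two_pow \<kappa>. x \<noteq> y \<longrightarrow> c {x, y} = j \<longrightarrow> g x \<noteq> (g y :: bool)" for j
  proof -
    define E where "E = {(x, y). x \<in> two_pow \<kappa> \<and> y \<in> two_pow \<kappa> \<and> x \<noteq> y \<and> c {x, y} = j}"
    have "sym E" "irrefl E" by (auto simp: E_def sym_def irrefl_def insert_commute)
    have "even n" if walk: "(a, a) \<in> E ^^ n" for a n
    proof (rule ccontr)
      assume "odd n"
      obtain k :: nat and x where k: "k \<ge> 3" "odd k" "inj_on x {..<k}"
        and path: "\<forall>i. i + 1 < k \<longrightarrow> (x i, x (i + 1)) \<in> E" and close: "(x (k - 1), x 0) \<in> E"
        using odd_closed_walk_imp_odd_cycle[OF \<open>irrefl E\<close> walk \<open>odd n\<close>] .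
      have "x i \<in> two_pow \<kappa>" if "i < k" for i
      proof (cases "i + 1 < k")
        case True
        with path show ?thesis by (simp add: E_def)
      next
        case False
        with that have "i = k - 1" by simp
        with close show ?thesis by (simp add: E_def)
      qed
      then have "monochromatic_odd_cycle \<kappa> c k x"
        unfolding monochromatic_odd_cycle_def using k path close
        by (intro conjI exI[of _ j]) (auto simp: E_def)
      with assms show False by blast
    qed
    with \<open>sym E\<close> obtain g where "\<And>x y. (x, y) \<in> E \<Longrightarrow> g x \<noteq> (g y :: bool)"
      using two_colouring_if_no_odd_closed_walk[of E] by metis
    then show ?thesis by (auto simp: E_def)
  qed
  then obtain f where "\<And>j. \<forall>x \<in> two_pow \<kappa>. \<forall>y \<in> two_pow \<kappa>. x \<noteq> y \<longrightarrow> c {x, y} = j \<longrightarrow>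
      f j x \<noteq> (f j y :: bool)"
    by metis
  with that show thesis by blast
qed

lemma
  assumes "Well_order \<kappa>" "x \<in> two_pow \<kappa>" "y \<in> two_pow \<kappa>" "x \<noteq> y"
  shows Delta_in_Field: "Delta \<kappa> x y \<in> Field \<kappa>"
    and Delta_differs: "x (Delta \<kappa> x y) \<noteq> y (Delta \<kappa> x y)"
proof -
  interpret wo_rel \<kappa> using assms(1) by (simp add: wo_rel_def)
  \<comment> \<open>Off \<open>Field \<kappa>\<close> all functions in
    \<open>two_pow \<kappa>\<close> are \<open>undefined\<close>, so distinct ones differ inside
    it.\<close>
  have "{i \<in> Field \<kappa>. x i \<noteq> y i} \<noteq> {}"
    using assms(2-4) by (force simp: two_pow_def Func_def fun_eq_iff)
  then have "Delta \<kappa> x y \<in> {i \<in> Field \<kappa>. x i \<noteq> y i}"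
    unfolding Delta_def by (intro minim_in) auto
  then show "Delta \<kappa> x y \<in> Field \<kappa>" "x (Delta \<kappa> x y) \<noteq> y (Delta \<kappa> x y)" by auto
qed

lemma Delta_least:
  assumes "Well_order \<kappa>" "i \<in> Field \<kappa>" "x i \<noteq> y i"
  shows "(Delta \<kappa> x y, i) \<in> \<kappa>"
proof -
  interpret wo_rel \<kappa> using assms(1) by (simp add: wo_rel_def)
  show ?thesis unfolding Delta_def using assms(2,3) by (intro minim_least) auto
qed

text \<open>Well-founded induction on \<open>Delta \<kappa> x y\<close>: as long as it is not below
  \<open>\<mu>\<close>, one application of \<open>F\<close> strictly lowers it.\<close>

lemma iterates_differ_below:
  assumes wo: "Well_order \<kappa>" and \<mu>: "\<mu> \<in> Field \<kappa>"
    and F: "\<And>x. x \<in> two_pow \<kappa> \<Longrightarrow> F x \<in> two_pow \<kappa>"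
    and regressive: "\<And>x y. x \<in> two_pow \<kappa> \<Longrightarrow> y \<in> two_pow \<kappa> \<Longrightarrow> x \<noteq> y \<Longrightarrow>
      \<exists>j. F x j \<noteq> F y j \<and> (j, wo_rel.max2 \<kappa> (Delta \<kappa> x y) \<mu>) \<in> \<kappa> - Id"
    and "x \<in> two_pow \<kappa>" "y \<in> two_pow \<kappa>" "x \<noteq> y"
  shows "\<exists>n. \<exists>i \<in> underS \<kappa> \<mu>. (F ^^ n) x i \<noteq> (F ^^ n) y i"
proof -
  let ?U = "underS \<kappa> \<mu>"
  interpret wo_rel \<kappa> using wo by (simp add: wo_rel_def)
  show ?thesis
    using assms(5-7)
  proof (induction "Delta \<kappa> x y" arbitrary: x y rule: wf_induct_rule[OF WF])
    case (1 x y)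
    note D = Delta_in_Field[OF wo "1.prems"] Delta_differs[OF wo "1.prems"]
    show ?case
    proof (cases "(Delta \<kappa> x y, \<mu>) \<in> \<kappa> - Id")
      case True
      with D show ?thesis by (intro exI[of _ 0] bexI[of _ "Delta \<kappa> x y"]) (auto simp: underS_def)
    next
      case False
      then have "max2 (Delta \<kappa> x y) \<mu> = Delta \<kappa> x y" by (auto simp: max2_def)
      with regressive[OF "1.prems"] obtain j
        where j: "F x j \<noteq> F y j" "(j, Delta \<kappa> x y) \<in> \<kappa> - Id" by auto
      then have "(Delta \<kappa> (F x) (F y), j) \<in> \<kappa>" by (intro Delta_least wo) (auto simp: Field_def)
      with j(2) have "(Delta \<kappa> (F x) (F y), Delta \<kappa> x y) \<in> \<kappa> - Id"
        using TRANS ANTISYM by (auto dest: transD antisymD)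
      moreover have "F x \<noteq> F y" using j(1) by auto
      ultimately obtain n i where "i \<in> ?U" "(F ^^ n) (F x) i \<noteq> (F ^^ n) (F y) i"
        using "1.hyps"[of "F x" "F y"] F "1.prems" by blast
      then show ?thesis
        by (intro exI[of _ "Suc n"] bexI[of _ i]) (auto simp: funpow_swap1)
    qed
  qed
qed

text \<open>The injection \<open>h\<close> codes pairs \<open>(n, i)\<close> by elements of
  \<open>A\<close>, so all the bits \<open>(F ^^ n) x i\<close> with \<open>i\<close> in
  \<open>U\<close> fit into a single function from \<open>A\<close> to \<open>bool\<close>. By
  separation this function determines \<open>x\<close>.\<close>

lemma card_of_separated_by_iterates:
  assumes h: "inj_on h ((UNIV :: nat set) \<times> U)" "h ` (UNIV \<times> U) \<subseteq> A"
    and separated: "\<And>x y. x \<in> X \<Longrightarrow> y \<in> X \<Longrightarrow> x \<noteq> y \<Longrightarrow>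
      \<exists>n. \<exists>i \<in> U. (F ^^ n) x i \<noteq> ((F ^^ n) y i :: bool)"
  shows "|X| \<le>o ctwo ^c |A|"
proof -
  define G where
    "G x a = (if a \<in> A then (\<exists>n. \<exists>i \<in> U. a = h (n, i) \<and> (F ^^ n) x i) else undefined)" for x a
  have G: "G x (h (n, i)) = (F ^^ n) x i" if "i \<in> U" for x n i
  proof -
    have "h (n, i) \<in> A" using that h(2) by auto
    then show ?thesis using that h(1) by (auto simp: G_def dest: inj_onD)
  qed
  have "x = y" if "x \<in> X" "y \<in> X" "G x = G y" for x y
    using separated[OF that(1,2)] G that(3) by metis
  then have "inj_on G X" by (auto intro: inj_onI)
  moreover have "G ` X \<subseteq> Func A UNIV" by (auto simp: G_def Func_def)
  ultimately show ?thesis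
    unfolding cexp_def ctwo_def Field_card_of card_of_ordLeq[symmetric] by blast
qed

lemma uncountable_Field_imp_natLeq_ordLess:
  assumes "Card_order \<kappa>" "uncountable (Field \<kappa>)"
  shows "natLeq <o \<kappa>"
proof -
  have "|UNIV :: nat set| <o |Field \<kappa>|"
    using assms(2) card_of_ordLess2 [of "Field \<kappa>" "UNIV :: nat set"]
    by (meson card_of_Well_order card_of_ordLeq countable_def not_ordLeq_iff_ordLess subset_UNIV)
  with assms(1) show ?thesis
    by (meson card_of_Field_ordIso card_of_nat ordIso_symmetric ordIso_ordLess_trans
        ordLess_ordIso_trans)
qed

text \<open>
  The set \<open>A\<close> plays the role of \<open>max |\<mu>| \<omega>\<close>. It lives in the type of \<open>\<kappa>\<close> because the hypothesis
  on powers of two only speaks about cardinals on that type.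
\<close>
lemma ex_infinite_superset_ordLess:
  assumes "Card_order \<kappa>" "uncountable (Field \<kappa>)" "\<mu> \<in> Field \<kappa>"
  obtains A where "underS \<kappa> \<mu> \<subseteq> A" "infinite A" "|A| <o \<kappa>"
proof -
  have inf: "infinite (Field \<kappa>)" using assms(2) countable_finite by blast
  \<comment> \<open>A countable \<open>B\<close> is small because \<kappa> is uncountable; adding it
    to \<open>underS \<kappa> \<mu>\<close> makes the union infinite.\<close>
  then obtain B where B: "B \<subseteq> Field \<kappa>" "countable B" "infinite B"
    using infinite_countable_subset' by blast
  have "|B| =o natLeq"
    using B by (meson card_of_ordIso card_of_nat ordIso_transitive to_nat_on_infinite)
  then have "|B| <o \<kappa>"
    using uncountable_Field_imp_natLeq_ordLess[OF assms(1,2)] ordIso_ordLess_trans by blast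
  moreover have "|underS \<kappa> \<mu>| <o \<kappa>" by (rule card_of_underS[OF assms(1,3)])
  ultimately have "|underS \<kappa> \<mu> \<union> B| <o \<kappa>"
    using inf assms(1) card_of_Un_ordLess_infinite_Field by blast
  with B show thesis by (intro that[of "underS \<kappa> \<mu> \<union> B"]) auto
qed

theorem theorem2p6:
  fixes \<kappa> :: "'k rel" and c :: "('k \<Rightarrow> bool) set \<Rightarrow> 'k"
  assumes "Card_order \<kappa>" and "uncountable (Field \<kappa>)"
    and "\<forall>\<mu> :: 'k rel. Card_order \<mu> \<and> \<mu> <o \<kappa> \<longrightarrow> ctwo ^c \<mu> <o ctwo ^c \<kappa>"
    and "c \<in> nsets (two_pow \<kappa>) 2 \<rightarrow> Field \<kappa>"
    and "almost_Delta_regressive \<kappa> c"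
  shows "\<exists>k x. monochromatic_odd_cycle \<kappa> c k x"
proof (rule ccontr)
  assume "\<nexists>k x. monochromatic_odd_cycle \<kappa> c k x"
  then obtain f :: "'k \<Rightarrow> ('k \<Rightarrow> bool) \<Rightarrow> bool" where f: "\<And>x y. x \<in> two_pow \<kappa> \<Longrightarrow>
      y \<in> two_pow \<kappa> \<Longrightarrow> x \<noteq> y \<Longrightarrow> f (c {x, y}) x \<noteq> f (c {x, y}) y"
    using monochromatic_odd_cycle_or_two_colourings by blast
  from assms(5) obtain \<mu> where \<mu>: "\<mu> \<in> Field \<kappa>" and regressive: "\<And>x y. x \<in> two_pow \<kappa> \<Longrightarrow>
      y \<in> two_pow \<kappa> \<Longrightarrow> x \<noteq> y \<Longrightarrow> (c {x, y}, wo_rel.max2 \<kappa> (Delta \<kappa> x y) \<mu>) \<in> \<kappa> - Id"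
    unfolding almost_Delta_regressive_def by blast
  have wo: "Well_order \<kappa>" using assms(1) by (simp add: card_order_on_well_order_on)
  \<comment> \<open>The default \<open>undefined\<close> off \<open>Field \<kappa>\<close> keeps
    \<open>F x\<close> inside \<open>two_pow \<kappa>\<close>.\<close>
  define F where "F x j = (if j \<in> Field \<kappa> then f j x else undefined)" for x j
  have F: "F x \<in> two_pow \<kappa>" for x by (auto simp: F_def two_pow_def Func_def)
  have F_differs: "F x (c {x, y}) \<noteq> F y (c {x, y})"
    if "x \<in> two_pow \<kappa>" "y \<in> two_pow \<kappa>" "x \<noteq> y" for x y
    \<comment> \<open>Regressivity puts the colour into \<open>Field \<kappa>\<close>, where
      \<open>F\<close> is given by \<open>f\<close>.\<close>
    using f[OF that] regressive[OF that] by (auto simp: F_def Field_def)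
  have separated: "\<exists>n. \<exists>i \<in> underS \<kappa> \<mu>. (F ^^ n) x i \<noteq> (F ^^ n) y i"
    if "x \<in> two_pow \<kappa>" "y \<in> two_pow \<kappa>" "x \<noteq> y" for x y
    using iterates_differ_below[where F = F, OF wo \<mu> F _ that] F_differs regressive by blast
  obtain A where A: "underS \<kappa> \<mu> \<subseteq> A" "infinite A" "|A| <o \<kappa>"
    using ex_infinite_superset_ordLess[OF assms(1,2) \<mu>] .
  \<comment> \<open>Since \<open>A\<close> is infinite, \<open>A \<times> A\<close> has the size of
    \<open>A\<close>; this yields the coding \<open>h\<close> of pairs of an iteration count and a
    position below \<open>\<mu>\<close>.\<close>
  have "|(UNIV :: nat set) \<times> underS \<kappa> \<mu>| \<le>o |A \<times> A|"
  proof -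
    have "|UNIV :: nat set| \<le>o |A|" using A(2) infinite_iff_card_of_nat by blast
    then show ?thesis
      using A(1) card_of_Times_mono1 card_of_Times_mono2 card_of_mono1 ordLeq_transitive by metis
  qed
  also have "|A \<times> A| =o |A|" using A(2) by (rule card_of_Times_same_infinite)
  finally obtain h where "inj_on h ((UNIV :: nat set) \<times> underS \<kappa> \<mu>)"
    "h ` (UNIV \<times> underS \<kappa> \<mu>) \<subseteq> A"
    by (auto simp: card_of_ordLeq[symmetric])
  from card_of_separated_by_iterates[OF this separated]
  have "|two_pow \<kappa>| \<le>o ctwo ^c |A|" .
  \<comment> \<open>An equality of relations, not only an isomorphism: \<open>cexp\<close> is
    defined as the cardinality of this very \<open>Func\<close> set.\<close>
  moreover have "|two_pow \<kappa>| = ctwo ^c \<kappa>" by (simp add: two_pow_def cexp_def ctwo_def Field_card_of)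
  moreover have "ctwo ^c |A| <o ctwo ^c \<kappa>" using assms(3) A(3) card_of_Card_order by blast
  ultimately show False using not_ordLess_ordLeq by auto
qed

end
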